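(* Let $((x^k,y^k))_{k\in\mathbf{N}}$ be generated by the iterate scheme in the context, with averages $\hat{x}_k=\frac{1}{k+1}\sum_{i=1}^{k+1}x^i$, $\hat{y}_k=\frac{1}{k+1}\sum_{i=1}^{k+1}y^i$. Suppose that $(x^{*},y^{*})\in X\times Y$ is a saddle-point of $f$. Let $k\in\mathbf{N}$. Then the following hold. (i) $$f(\hat{x}_k,\hat{y}_k)-f(x^{*},y^{*})\le\frac{1}{k+1}\sum_{i=0}^{k}\frac{1}{2\tau_i}\big(\|x^{*}-x^i\|^2-\|x^{*}-x^{i+1}\|^2-\|x^i-x^{i+1}\|^2\big)$$ $$+\frac{1}{k+1}\sum_{i=0}^{k}\frac{1}{2\sigma_i}\big(\|\hat{y}_k-y^i\|^2-\|\hat{y}_k-y^{i+1}\|^2-\|y^i-y^{i+1}\|^2\big)$$ $$+\frac{1}{k+1}\sum_{i=0}^{k}\big(f(x^{i+1},\hat{y}_k)-f(\bar{x}^i,\hat{y}_k)+f(\bar{x}^i,y^{i+1})-f(x^{*},y^{i+1})-f(x^{i+1},\bar{y}^{i+1})+f(x^{*},\bar{y}^{i+1})\big).$$ (ii) $$f(x^{*},y^{*})-f(\hat{x}_k,\hat{y}_k)\le\frac{1}{k+1}\sum_{i=0}^{k}\frac{1}{2\tau_i}\big(\|\hat{x}_k-x^i\|^2-\|\hat{x}_k-x^{i+1}\|^2-\|x^i-x^{i+1}\|^2\big)$$ $$+\frac{1}{k+1}\sum_{i=0}^{k}\frac{1}{2\sigma_i}\big(\|y^{*}-y^i\|^2-\|y^{*}-y^{i+1}\|^2-\|y^i-y^{i+1}\|^2\big)$$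 $$+\frac{1}{k+1}\sum_{i=0}^{k}\big(f(x^{i+1},y^{*})-f(\bar{x}^i,y^{*})+f(\bar{x}^i,y^{i+1})-f(\hat{x}_k,y^{i+1})-f(x^{i+1},\bar{y}^{i+1})+f(\hat{x}_k,\bar{y}^{i+1})\big).$$
   Context: $\mathbf{N}$ is the set of nonnegative integers. $\mathcal{H}_1,\mathcal{H}_2$ are Hilbert spaces; $X\subseteq\mathcal{H}_1$ and $Y\subseteq\mathcal{H}_2$ are nonempty, closed and convex. $f:X\times Y\to\mathbf{R}\cup\{-\infty,+\infty\}$ is such that for every $y\in Y$, $f(\cdot,y):X\to\mathbf{R}\cup\{+\infty\}$ is proper, convex, and lower semicontinuous, and for every $x\in X$, $f(x,\cdot):Y\to\mathbf{R}\cup\{-\infty\}$ is such that $-f(x,\cdot)$ is proper, convex, and lower semicontinuous. A saddle-point of $f$ is $(x^{*},y^{*})\in X\times Y$ with $f(x^{*},y)\le f(x^{*},y^{*})\le f(x,y^{*})$ for all $x\in X$, $y\in Y$. Parameters: $(\tau_k)_{k\in\mathbf{N}},(\sigma_k)_{k\in\mathbf{N}}$ are sequences of positive reals and $(\alpha_k)_{k\in\mathbf{N}\cup\{-1\}},(\beta_k)_{k\in\mathbf{N}\cup\{-1\}}$ are sequences of nonnegative reals. Iterate scheme: given $(x^0,y^0)\in X\times Y$, set $\bar{x}^0=x^0$, $\bar{y}^0=y^0$, and for every $k\in\mathbf{N}$: $y^{k+1}=\operatorname{argmax}_{y\in Y}\{f(\bar{x}^k,y)-\frac{1}{2\sigma_k}\|y-y^k\|^2\}$;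 $\bar{y}^{k+1}=y^{k+1}+\beta_k(y^{k+1}-y^k)$; $x^{k+1}=\operatorname{argmin}_{x\in X}\{f(x,\bar{y}^{k+1})+\frac{1}{2\tau_k}\|x-x^k\|^2\}$; $\bar{x}^{k+1}=x^{k+1}+\alpha_k(x^{k+1}-x^k)$. *)

theory Defs
  imports "HOL-Analysis.Analysis"
begin

text \<open>
  Extended-real functions on a set \<open>S\<close> are total functions into \<^typ>\<open>ereal\<close>; only their
  values on \<open>S\<close> are constrained.
\<close>

definition proper_on :: "'a set \<Rightarrow> ('a \<Rightarrow> ereal) \<Rightarrow> bool" where
  "proper_on S g \<longleftrightarrow> (\<forall>x\<in>S. g x \<noteq> -\<infinity>) \<and> (\<exists>x\<in>S. g x \<noteq> \<infinity>)"

text \<open>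
  The counterpart of \<^const>\<open>convex_on\<close>, which is restricted to real-valued functions. It is only
  used for functions that never take the value \<open>-\<infinity>\<close>, so the sum on the right is never of the
  form \<open>\<infinity> - \<infinity>\<close>; in \<^typ>\<open>ereal\<close>, \<open>0 * \<infinity> = 0\<close>.
\<close>

definition ereal_convex_on :: "'a::real_vector set \<Rightarrow> ('a \<Rightarrow> ereal) \<Rightarrow> bool" where
  "ereal_convex_on S g \<longleftrightarrow> convex S \<and>
    (\<forall>x\<in>S. \<forall>y\<in>S. \<forall>u\<ge>0. \<forall>v\<ge>0. u + v = 1 \<longrightarrow>
      g (u *\<^sub>R x + v *\<^sub>R y) \<le> ereal u * g x + ereal v * g y)"

text \<open>
  The filter \<open>at x within S\<close> omits \<open>x\<close> itself, which does not affect the inequality; at an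
  isolated point of \<open>S\<close> the limit inferior is \<open>\<infinity>\<close> and the condition is void.
\<close>

definition lsc_on :: "'a::topological_space set \<Rightarrow> ('a \<Rightarrow> ereal) \<Rightarrow> bool" where
  "lsc_on S g \<longleftrightarrow> (\<forall>x\<in>S. g x \<le> Liminf (at x within S) g)"

definition proper_convex_lsc_on ::
    "'a::{real_vector, topological_space} set \<Rightarrow> ('a \<Rightarrow> ereal) \<Rightarrow> bool" where
  "proper_convex_lsc_on S g \<longleftrightarrow> proper_on S g \<and> ereal_convex_on S g \<and> lsc_on S g"

definition convex_concave_on ::
    "'a::{real_vector, topological_space} set \<Rightarrow> 'b::{real_vector, topological_space} set
      \<Rightarrow> ('a \<Rightarrow> 'b \<Rightarrow> ereal) \<Rightarrow> bool" where
  "convex_concave_on X Y f \<longleftrightarrow>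
    (\<forall>y\<in>Y. proper_convex_lsc_on X (\<lambda>x. f x y)) \<and>
    (\<forall>x\<in>X. proper_convex_lsc_on Y (\<lambda>y. - f x y))"

definition saddle_point ::
    "'a set \<Rightarrow> 'b set \<Rightarrow> ('a \<Rightarrow> 'b \<Rightarrow> ereal) \<Rightarrow> 'a \<Rightarrow> 'b \<Rightarrow> bool" where
  "saddle_point X Y f xs ys \<longleftrightarrow> xs \<in> X \<and> ys \<in> Y \<and>
    (\<forall>x\<in>X. \<forall>y\<in>Y. f xs y \<le> f xs ys \<and> f xs ys \<le> f x ys)"

text \<open>
  The sequences \<open>\<alpha>\<close>, \<open>\<beta>\<close> are indexed from \<open>-1\<close>, hence by \<^typ>\<open>int\<close>; their values below \<open>-1\<close> are
  irrelevant. The extrapolated points \<open>xb k\<close>, \<open>yb k\<close> are arguments of \<open>f\<close>, whose domain is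
  \<open>X \<times> Y\<close>; the scheme is therefore only defined if they belong to \<open>X\<close>, \<open>Y\<close>, which is recorded
  explicitly since \<open>f\<close> is represented by a total function.
\<close>

definition iterate_scheme ::
    "'a::real_normed_vector set \<Rightarrow> 'b::real_normed_vector set \<Rightarrow> ('a \<Rightarrow> 'b \<Rightarrow> ereal)
      \<Rightarrow> (nat \<Rightarrow> real) \<Rightarrow> (nat \<Rightarrow> real) \<Rightarrow> (int \<Rightarrow> real) \<Rightarrow> (int \<Rightarrow> real)
      \<Rightarrow> (nat \<Rightarrow> 'a) \<Rightarrow> (nat \<Rightarrow> 'b) \<Rightarrow> (nat \<Rightarrow> 'a) \<Rightarrow> (nat \<Rightarrow> 'b) \<Rightarrow> bool" where
  "iterate_scheme X Y f \<tau> \<sigma> \<alpha> \<beta> x y xb yb \<longleftrightarrow>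
    x 0 \<in> X \<and> y 0 \<in> Y \<and> xb 0 = x 0 \<and> yb 0 = y 0 \<and>
    (\<forall>k. xb k \<in> X \<and> yb k \<in> Y) \<and>
    (\<forall>k. is_arg_max (\<lambda>v. f (xb k) v - ereal (1 / (2 * \<sigma> k) * (norm (v - y k))\<^sup>2))
           (\<lambda>v. v \<in> Y) (y (Suc k)) \<and>
         yb (Suc k) = y (Suc k) + \<beta> (int k) *\<^sub>R (y (Suc k) - y k) \<and>
         is_arg_min (\<lambda>u. f u (yb (Suc k)) + ereal (1 / (2 * \<tau> k) * (norm (u - x k))\<^sup>2))
           (\<lambda>u. u \<in> X) (x (Suc k)) \<and>
         xb (Suc k) = x (Suc k) + \<alpha> (int k) *\<^sub>R (x (Suc k) - x k))"

definition iterate_avg :: "(nat \<Rightarrow> 'a::real_vector) \<Rightarrow> nat \<Rightarrow> 'a" where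
  "iterate_avg z k = (1 / (real k + 1)) *\<^sub>R (\<Sum>i=1..k+1. z i)"

end

theory Submission
  imports Defs
begin

text \<open>
  Properness of \<open>f\<close> in its first and of \<open>- f\<close> in its second variable excludes both infinite values
  on \<open>X \<times> Y\<close> (\<open>convex_concave_on_finite\<close>), so the argument takes place with a real
  function \<open>g\<close>, convex in its first and concave in its second variable.

  A minimiser \<open>z\<close> of \<open>h s + c \<parallel>s - w\<parallel>\<^sup>2\<close> with \<open>h\<close> convex satisfies not only the inequality of the
  two values, but one sharpened by \<open>c \<parallel>u - z\<parallel>\<^sup>2\<close> at every competitor \<open>u\<close>, because the objective
  is as curved as its quadratic part (\<open>proximal_three_point\<close>). Applied to the update of
  \<open>x\<close> with a comparison point \<open>u\<close>, and to the update of \<open>y\<close>, where \<open>h\<close> is \<open>- g xb\<^sub>i\<close>, with a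
  comparison point \<open>v\<close>, it bounds \<open>g x\<^sub>i\<^sub>+\<^sub>1 yb\<^sub>i\<^sub>+\<^sub>1 - g u yb\<^sub>i\<^sub>+\<^sub>1\<close> and \<open>g xb\<^sub>i v - g xb\<^sub>i y\<^sub>i\<^sub>+\<^sub>1\<close>.
  The difference \<open>g x\<^sub>i\<^sub>+\<^sub>1 v - g u y\<^sub>i\<^sub>+\<^sub>1\<close> is the sum of these two quantities and of the coupling terms
  of the theorem; hence its average over \<open>i\<close> is bounded by the right-hand side
  (\<open>average_gap_bound\<close>).

  Both claims are instances. For the first, take \<open>u = xs\<close> and let \<open>v\<close> be the average of the \<open>y\<^sub>i\<^sub>+\<^sub>1\<close>: by
  Jensen's inequality the mean of \<open>g x\<^sub>i\<^sub>+\<^sub>1 v\<close> is at least the value of \<open>g\<close> at the two averages, and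
  by the saddle-point property every \<open>g xs y\<^sub>i\<^sub>+\<^sub>1\<close> is at most \<open>g xs ys\<close>. For the second, let \<open>u\<close> be the
  average of the \<open>x\<^sub>i\<^sub>+\<^sub>1\<close> and \<open>v = ys\<close>; then Jensen's inequality is used for
  \<open>- g u\<close> and the saddle-point property for \<open>g x\<^sub>i\<^sub>+\<^sub>1 ys\<close>.
\<close>

section \<open>Finite values on the product\<close>

text \<open>
  The value \<open>-\<infinity>\<close> is excluded by properness in the first variable, and \<open>\<infinity>\<close> by properness of
  \<open>- f u\<close>.
\<close>

lemma convex_concave_on_finite:
  assumes "convex_concave_on X Y f" "u \<in> X" "v \<in> Y"
  shows "f u v = ereal (real_of_ereal (f u v))"
proof -
  have "f u v \<noteq> -\<infinity>" "- f u v \<noteq> -\<infinity>"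
    using assms unfolding convex_concave_on_def proper_convex_lsc_on_def proper_on_def by blast+
  then have "\<bar>f u v\<bar> \<noteq> \<infinity>"
    by auto
  then show ?thesis
    by (simp add: ereal_real)
qed

lemma ereal_convex_on_imp_convex_on:
  assumes "ereal_convex_on S (\<lambda>s. ereal (h s))"
  shows "convex_on S h"
  using assms unfolding ereal_convex_on_def convex_on_def by simp

lemma ereal_convex_on_cong:
  assumes "ereal_convex_on S g" "\<And>s. s \<in> S \<Longrightarrow> g s = h s"
  shows "ereal_convex_on S h"
proof -
  have "convex S"
    using assms(1) by (simp add: ereal_convex_on_def)
  then have "u *\<^sub>R a + v *\<^sub>R b \<in> S" if "a \<in> S" "b \<in> S" "0 \<le> u" "0 \<le> v" "u + v = 1" for u v a b
    using that by (simp add: convexD)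
  with assms show ?thesis
    by (simp add: ereal_convex_on_def)
qed

lemma convex_concave_on_real_parts:
  assumes "convex_concave_on X Y f"
  shows "v \<in> Y \<Longrightarrow> convex_on X (\<lambda>u. real_of_ereal (f u v))"
    and "u \<in> X \<Longrightarrow> convex_on Y (\<lambda>v. - real_of_ereal (f u v))"
proof -
  assume "v \<in> Y"
  then have "ereal_convex_on X (\<lambda>u. f u v)"
    using assms by (simp add: convex_concave_on_def proper_convex_lsc_on_def)
  then have "ereal_convex_on X (\<lambda>u. ereal (real_of_ereal (f u v)))"
    by (rule ereal_convex_on_cong) (rule convex_concave_on_finite[OF assms _ \<open>v \<in> Y\<close>])
  then show "convex_on X (\<lambda>u. real_of_ereal (f u v))"
    by (rule ereal_convex_on_imp_convex_on)
next
  assume "u \<in> X"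
  then have "ereal_convex_on Y (\<lambda>v. - f u v)"
    using assms by (simp add: convex_concave_on_def proper_convex_lsc_on_def)
  then have "ereal_convex_on Y (\<lambda>v. ereal (- real_of_ereal (f u v)))"
  proof (rule ereal_convex_on_cong)
    fix v assume "v \<in> Y"
    with assms \<open>u \<in> X\<close> have "f u v = ereal (real_of_ereal (f u v))"
      by (intro convex_concave_on_finite)
    then show "- f u v = ereal (- real_of_ereal (f u v))"
      by (metis uminus_ereal.simps(1))
  qed
  then show "convex_on Y (\<lambda>v. - real_of_ereal (f u v))"
    by (rule ereal_convex_on_imp_convex_on)
qed

section \<open>The proximal three-point inequality\<close>

text \<open>
  The minimality of \<open>z\<close> is tested at \<open>z + t (u - z)\<close>. By convexity of \<open>h\<close>, all terms that do not
  vanish as \<open>t \<rightarrow> 0\<close> after division by \<open>t\<close> are \<open>h z - h u\<close> and \<open>2 c (z - w) \<bullet> (u - z)\<close>, and the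
  latter expands into the three squares.
\<close>

lemma proximal_three_point:
  fixes h :: "'a::real_inner \<Rightarrow> real"
  assumes h: "convex_on S h" and z: "z \<in> S" and u: "u \<in> S"
    and min: "\<And>s. s \<in> S \<Longrightarrow> h z + c * (norm (z - w))\<^sup>2 \<le> h s + c * (norm (s - w))\<^sup>2"
  shows "h z - h u \<le> c * ((norm (u - w))\<^sup>2 - (norm (u - z))\<^sup>2 - (norm (w - z))\<^sup>2)"
proof -
  let ?i = "(z - w) \<bullet> (u - z)" and ?n = "(norm (u - z))\<^sup>2"
  have bound: "h z - h u \<le> c * (2 * ?i + t * ?n)" if t: "0 < t" "t < 1" for t
  proof -
    let ?s = "(1 - t) *\<^sub>R z + t *\<^sub>R u"
    have "?s \<in> S"
      using t z u convex_on_imp_convex[OF h] by (simp add: convexD)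
    have "h ?s \<le> (1 - t) * h z + t * h u"
      using convex_onD[OF h, of t z u] t z u by simp
    moreover have "(norm (?s - w))\<^sup>2 = (norm (z - w))\<^sup>2 + t * (2 * ?i + t * ?n)"
    proof -
      have "?s - w = (z - w) + t *\<^sub>R (u - z)"
        by (simp add: algebra_simps)
      then have "(norm (?s - w))\<^sup>2 = (norm (z - w))\<^sup>2 + 2 * ((z - w) \<bullet> (t *\<^sub>R (u - z)))
          + (norm (t *\<^sub>R (u - z)))\<^sup>2"
        by (simp only: power2_norm_eq_inner inner_add_left inner_add_right) (simp add: inner_commute)
      then show ?thesis
        by (simp only: norm_scaleR inner_scaleR_right power_mult_distrib power2_abs)
          (simp add: power2_eq_square distrib_left)
    qed
    ultimately have "h z + c * (norm (z - w))\<^sup>2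
        \<le> (1 - t) * h z + t * h u + c * ((norm (z - w))\<^sup>2 + t * (2 * ?i + t * ?n))"
      using min[OF \<open>?s \<in> S\<close>] by simp
    then have "t * (h z - h u) \<le> t * (c * (2 * ?i + t * ?n))"
      by (simp add: algebra_simps)
    with t show ?thesis
      by simp
  qed
  have "((\<lambda>t. c * (2 * ?i + t * ?n)) \<longlongrightarrow> c * (2 * ?i + 0 * ?n)) (at_right 0)"
    by (intro tendsto_intros)
  moreover have "\<forall>\<^sub>F t::real in at_right 0. h z - h u \<le> c * (2 * ?i + t * ?n)"
    using bound by (auto simp: eventually_at_right_field intro!: exI[of _ 1])
  ultimately have "h z - h u \<le> c * (2 * ?i)"
    using tendsto_lowerbound by fastforce
  also have "2 * ?i = (norm (u - w))\<^sup>2 - (norm (u - z))\<^sup>2 - (norm (w - z))\<^sup>2"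
    by (simp add: power2_norm_eq_inner inner_diff_left inner_diff_right inner_commute)
  finally show ?thesis .
qed

section \<open>Averages\<close>

lemma iterate_avg_eq:
  "iterate_avg z k = (\<Sum>i=0..k. (1 / (real k + 1)) *\<^sub>R z (i + 1))"
  using sum.shift_bounds_cl_Suc_ivl[of z 0 k]
  by (simp add: iterate_avg_def scaleR_sum_right)

lemma iterate_avg_in:
  assumes "convex S" "\<And>i. z i \<in> S"
  shows "iterate_avg z k \<in> S"
  unfolding iterate_avg_eq using assms by (intro convex_sum) auto

lemma convex_on_iterate_avg_le:
  assumes "convex_on S h" "\<And>i. z i \<in> S"
  shows "h (iterate_avg z k) \<le> 1 / (real k + 1) * (\<Sum>i=0..k. h (z (i + 1)))"
proof -
  have "h (\<Sum>i=0..k. (1 / (real k + 1)) *\<^sub>R z (i + 1)) \<le> (\<Sum>i=0..k. 1 / (real k + 1) * h (z (i + 1)))"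
    using assms by (intro convex_on_sum) auto
  then show ?thesis
    by (simp add: iterate_avg_eq sum_distrib_left)
qed

section \<open>The averaged gap\<close>

text \<open>
  The summand on the left equals
  \<open>(g x\<^sub>i\<^sub>+\<^sub>1 yb\<^sub>i\<^sub>+\<^sub>1 - g u yb\<^sub>i\<^sub>+\<^sub>1) + (g xb\<^sub>i v - g xb\<^sub>i y\<^sub>i\<^sub>+\<^sub>1)\<close> plus the coupling terms, so the two
  three-point inequalities give the bound already for each \<open>i\<close> separately. The comparison points are
  arbitrary because the two claims of the theorem choose them differently.
\<close>

lemma average_gap_bound:
  fixes g :: "'a::real_inner \<Rightarrow> 'b::real_inner \<Rightarrow> real"
  assumes cx: "\<And>v. v \<in> Y \<Longrightarrow> convex_on X (\<lambda>u. g u v)"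
    and cv: "\<And>u. u \<in> X \<Longrightarrow> convex_on Y (\<lambda>v. - g u v)"
    and inX: "\<And>i. x i \<in> X" "\<And>i. xb i \<in> X" "u \<in> X"
    and inY: "\<And>i. y i \<in> Y" "\<And>i. yb i \<in> Y" "v \<in> Y"
    and y_step: "\<And>i t. t \<in> Y \<Longrightarrow>
      g (xb i) t - 1 / (2 * \<sigma> i) * (norm (t - y i))\<^sup>2
        \<le> g (xb i) (y (i + 1)) - 1 / (2 * \<sigma> i) * (norm (y (i + 1) - y i))\<^sup>2"
    and x_step: "\<And>i s. s \<in> X \<Longrightarrow>
      g (x (i + 1)) (yb (i + 1)) + 1 / (2 * \<tau> i) * (norm (x (i + 1) - x i))\<^sup>2
        \<le> g s (yb (i + 1)) + 1 / (2 * \<tau> i) * (norm (s - x i))\<^sup>2"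
  shows "1 / (real k + 1) * (\<Sum>i=0..k. g (x (i + 1)) v - g u (y (i + 1)))
    \<le> 1 / (real k + 1) * (\<Sum>i=0..k. 1 / (2 * \<tau> i) *
          ((norm (u - x i))\<^sup>2 - (norm (u - x (i + 1)))\<^sup>2 - (norm (x i - x (i + 1)))\<^sup>2))
      + 1 / (real k + 1) * (\<Sum>i=0..k. 1 / (2 * \<sigma> i) *
          ((norm (v - y i))\<^sup>2 - (norm (v - y (i + 1)))\<^sup>2 - (norm (y i - y (i + 1)))\<^sup>2))
      + 1 / (real k + 1) * (\<Sum>i=0..k.
          g (x (i + 1)) v - g (xb i) v + g (xb i) (y (i + 1)) - g u (y (i + 1))
          - g (x (i + 1)) (yb (i + 1)) + g u (yb (i + 1)))"
proof -
  define A where "A i = 1 / (2 * \<tau> i) *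
    ((norm (u - x i))\<^sup>2 - (norm (u - x (i + 1)))\<^sup>2 - (norm (x i - x (i + 1)))\<^sup>2)" for i
  define B where "B i = 1 / (2 * \<sigma> i) *
    ((norm (v - y i))\<^sup>2 - (norm (v - y (i + 1)))\<^sup>2 - (norm (y i - y (i + 1)))\<^sup>2)" for i
  define C where "C i = g (x (i + 1)) v - g (xb i) v + g (xb i) (y (i + 1)) - g u (y (i + 1))
    - g (x (i + 1)) (yb (i + 1)) + g u (yb (i + 1))" for i
  have "g (x (i + 1)) v - g u (y (i + 1)) \<le> A i + B i + C i" for i
  proof -
    have "g (x (i + 1)) (yb (i + 1)) - g u (yb (i + 1)) \<le> A i"
      unfolding A_def by (rule proximal_three_point[OF cx[OF inY(2)] inX(1) inX(3) x_step])
    moreover have "- g (xb i) (y (i + 1)) - - g (xb i) v \<le> B i"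
      unfolding B_def
    proof (rule proximal_three_point[OF cv[OF inX(2)] inY(1) inY(3)])
      fix t assume "t \<in> Y"
      from y_step[OF this, of i]
      show "- g (xb i) (y (i + 1)) + 1 / (2 * \<sigma> i) * (norm (y (i + 1) - y i))\<^sup>2
          \<le> - g (xb i) t + 1 / (2 * \<sigma> i) * (norm (t - y i))\<^sup>2"
        by simp
    qed
    ultimately show ?thesis
      by (simp add: C_def)
  qed
  then have "(\<Sum>i=0..k. g (x (i + 1)) v - g u (y (i + 1))) \<le> (\<Sum>i=0..k. A i + B i + C i)"
    by (intro sum_mono)
  then have "1 / (real k + 1) * (\<Sum>i=0..k. g (x (i + 1)) v - g u (y (i + 1)))
      \<le> 1 / (real k + 1) * (\<Sum>i=0..k. A i + B i + C i)"
    by (intro mult_left_mono) auto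
  then show ?thesis
    unfolding A_def B_def C_def by (simp only: sum.distrib distrib_left)
qed

section \<open>The two bounds\<close>

theorem proposition3p1:
  fixes X :: "'a::{real_inner, complete_space} set"
    and Y :: "'b::{real_inner, complete_space} set"
    and f :: "'a \<Rightarrow> 'b \<Rightarrow> ereal"
    and \<tau> \<sigma> :: "nat \<Rightarrow> real"
    and \<alpha> \<beta> :: "int \<Rightarrow> real"
    and x xb :: "nat \<Rightarrow> 'a" and y yb :: "nat \<Rightarrow> 'b"
    and xs :: 'a and ys :: 'b
    and k :: nat
  assumes "X \<noteq> {}" and "closed X" and "convex X"
    and "Y \<noteq> {}" and "closed Y" and "convex Y"
    and "convex_concave_on X Y f"
    and "\<And>i. 0 < \<tau> i" and "\<And>i. 0 < \<sigma> i"
    and "\<And>i. -1 \<le> i \<Longrightarrow> 0 \<le> \<alpha> i" and "\<And>i. -1 \<le> i \<Longrightarrow> 0 \<le> \<beta> i"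
    and "iterate_scheme X Y f \<tau> \<sigma> \<alpha> \<beta> x y xb yb"
    and "saddle_point X Y f xs ys"
  shows
    "f (iterate_avg x k) (iterate_avg y k) - f xs ys
      \<le> ereal (1 / (real k + 1) * (\<Sum>i=0..k. 1 / (2 * \<tau> i) *
            ((norm (xs - x i))\<^sup>2 - (norm (xs - x (i + 1)))\<^sup>2 - (norm (x i - x (i + 1)))\<^sup>2)))
        + ereal (1 / (real k + 1) * (\<Sum>i=0..k. 1 / (2 * \<sigma> i) *
            ((norm (iterate_avg y k - y i))\<^sup>2 - (norm (iterate_avg y k - y (i + 1)))\<^sup>2
              - (norm (y i - y (i + 1)))\<^sup>2)))
        + ereal (1 / (real k + 1)) * (\<Sum>i=0..k.
            f (x (i + 1)) (iterate_avg y k) - f (xb i) (iterate_avg y k)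
            + f (xb i) (y (i + 1)) - f xs (y (i + 1))
            - f (x (i + 1)) (yb (i + 1)) + f xs (yb (i + 1)))
     \<and>
     f xs ys - f (iterate_avg x k) (iterate_avg y k)
      \<le> ereal (1 / (real k + 1) * (\<Sum>i=0..k. 1 / (2 * \<tau> i) *
            ((norm (iterate_avg x k - x i))\<^sup>2 - (norm (iterate_avg x k - x (i + 1)))\<^sup>2
              - (norm (x i - x (i + 1)))\<^sup>2)))
        + ereal (1 / (real k + 1) * (\<Sum>i=0..k. 1 / (2 * \<sigma> i) *
            ((norm (ys - y i))\<^sup>2 - (norm (ys - y (i + 1)))\<^sup>2 - (norm (y i - y (i + 1)))\<^sup>2)))
        + ereal (1 / (real k + 1)) * (\<Sum>i=0..k.
            f (x (i + 1)) ys - f (xb i) ys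
            + f (xb i) (y (i + 1)) - f (iterate_avg x k) (y (i + 1))
            - f (x (i + 1)) (yb (i + 1)) + f (iterate_avg x k) (yb (i + 1)))"
proof -
  define g where "g u v = real_of_ereal (f u v)" for u v
  note cc = assms(7)
  have fg: "f u v = ereal (g u v)" if "u \<in> X" "v \<in> Y" for u v
    unfolding g_def using cc that by (rule convex_concave_on_finite)
  have cx: "convex_on X (\<lambda>u. g u v)" if "v \<in> Y" for v
    unfolding g_def using cc that by (rule convex_concave_on_real_parts(1))
  have cv: "convex_on Y (\<lambda>v. - g u v)" if "u \<in> X" for u
    unfolding g_def using cc that by (rule convex_concave_on_real_parts(2))

  have b: "xb i \<in> X" "yb i \<in> Y" for i
    using assms(12) by (auto simp: iterate_scheme_def)
  have xX: "x i \<in> X" for i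
    using assms(12) by (cases i) (auto simp: iterate_scheme_def is_arg_min_def)
  have yY: "y i \<in> Y" for i
    using assms(12) by (cases i) (auto simp: iterate_scheme_def is_arg_max_def)
  have y_step: "g (xb i) t - 1 / (2 * \<sigma> i) * (norm (t - y i))\<^sup>2
      \<le> g (xb i) (y (i + 1)) - 1 / (2 * \<sigma> i) * (norm (y (i + 1) - y i))\<^sup>2"
    if "t \<in> Y" for i t
  proof -
    have "f (xb i) t - ereal (1 / (2 * \<sigma> i) * (norm (t - y i))\<^sup>2)
        \<le> f (xb i) (y (i + 1)) - ereal (1 / (2 * \<sigma> i) * (norm (y (i + 1) - y i))\<^sup>2)"
      using assms(12) that unfolding iterate_scheme_def is_arg_max_linorder Suc_eq_plus1 by blast
    then show ?thesis
      using that by (simp add: fg b yY)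
  qed
  have x_step: "g (x (i + 1)) (yb (i + 1)) + 1 / (2 * \<tau> i) * (norm (x (i + 1) - x i))\<^sup>2
      \<le> g s (yb (i + 1)) + 1 / (2 * \<tau> i) * (norm (s - x i))\<^sup>2"
    if "s \<in> X" for i s
  proof -
    have "f (x (i + 1)) (yb (i + 1)) + ereal (1 / (2 * \<tau> i) * (norm (x (i + 1) - x i))\<^sup>2)
        \<le> f s (yb (i + 1)) + ereal (1 / (2 * \<tau> i) * (norm (s - x i))\<^sup>2)"
      using assms(12) that unfolding iterate_scheme_def is_arg_min_linorder Suc_eq_plus1 by blast
    then show ?thesis
      using that by (simp add: fg b xX)
  qed

  note bound = average_gap_bound[where X = X and Y = Y and g = g and x = x and xb = xb and y = y
      and yb = yb and \<sigma> = \<sigma> and \<tau> = \<tau> and k = k]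

  let ?xa = "iterate_avg x k" and ?ya = "iterate_avg y k" and ?c = "1 / (real k + 1)"
  have xa: "?xa \<in> X" and ya: "?ya \<in> Y"
    using assms(3,6) xX yY by (auto intro: iterate_avg_in)
  have sX: "xs \<in> X" and sY: "ys \<in> Y"
    using assms(13) by (auto simp: saddle_point_def)
  have saddle: "g xs v \<le> g xs ys" "g xs ys \<le> g u ys" if "u \<in> X" "v \<in> Y" for u v
    using assms(13) that sX sY by (auto simp: saddle_point_def fg)
  have mean_const: "?c * (\<Sum>i=0..k. a) = a" for a :: real
    by (simp add: field_simps)

  have "g ?xa ?ya - g xs ys \<le> ?c * (\<Sum>i=0..k. g (x (i + 1)) ?ya - g xs (y (i + 1)))"
  proof -
    have "g ?xa ?ya \<le> ?c * (\<Sum>i=0..k. g (x (i + 1)) ?ya)"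
      using cx[OF ya] xX by (rule convex_on_iterate_avg_le)
    moreover have "?c * (\<Sum>i=0..k. g xs (y (i + 1))) \<le> ?c * (\<Sum>i=0..k. g xs ys)"
      using saddle(1)[OF sX yY] by (intro mult_left_mono sum_mono) auto
    ultimately show ?thesis
      unfolding mean_const by (simp add: sum_subtractf right_diff_distrib)
  qed
  note gap1 = order_trans[OF this
      bound[OF cx cv xX b(1) sX yY b(2) ya y_step x_step]]

  have "g xs ys - g ?xa ?ya \<le> ?c * (\<Sum>i=0..k. g (x (i + 1)) ys - g ?xa (y (i + 1)))"
  proof -
    have "- g ?xa ?ya \<le> ?c * (\<Sum>i=0..k. - g ?xa (y (i + 1)))"
      using cv[OF xa] yY by (rule convex_on_iterate_avg_le)
    moreover have "?c * (\<Sum>i=0..k. g xs ys) \<le> ?c * (\<Sum>i=0..k. g (x (i + 1)) ys)"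
      using saddle(2)[OF xX sY] by (intro mult_left_mono sum_mono) auto
    ultimately show ?thesis
      unfolding mean_const by (simp add: sum_subtractf sum_negf right_diff_distrib)
  qed
  note gap2 = order_trans[OF this
      bound[OF cx cv xX b(1) xa yY b(2) sY y_step x_step]]

  (* Every argument of f lies in X \<times> Y, so all extended-real operations are those of the reals. *)
  from gap1 gap2 show ?thesis
    by (simp only: fg xX yY b xa ya sX sY ereal_minus(1) plus_ereal.simps times_ereal.simps
        sum_ereal ereal_less_eq simp_thms)
qed

end
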